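(* Let $(E,\pi,B)$ be a complex vector bundle with fibres of complex dimension $n$ and let $g$ be a Hermitian bundle metric on it. A necessary and sufficient condition for the existence of a ($\mathbb{C}$-)linear transport along paths globally consistent with $g$ (resp. locally consistent with $g$, i.e. consistent with $g$ along a given path $\gamma:J\to B$) is the independence of the signature (and consequently, of the number of positive (and/or negative) eigenvalues) of that metric, i.e. of the matrix $G(x)$, from the point at which it is evaluated, i.e. from $x\in B$ (resp. from $x\in\gamma(J)$).
   Context: Paths in $B$ are denoted $\gamma:J\to B$, with $J$ an arbitrary real interval. A Hermitian bundle metric $g$ assigns to each $x\in B$ a map $g_x:\pi^{-1}(x)\times\pi^{-1}(x)\to\mathbb{C}$ that is sesquilinear (linear in the first and conjugate-linear in the second argument), nondegenerate, and Hermitian, $g_x(u,v)=\overline{g_x(v,u)}$. Positive definiteness is not assumed. A linear transport along paths $L$ assigns to each path $\gamma:J\to B$ and $s,t\in J$ a $\mathbb{C}$-linear map $L^\gamma_{s\to t}:\pi^{-1}(\gamma(s))\to\pi^{-1}(\gamma(t))$ with $L^\gamma_{t\to r}\circ L^\gamma_{s\to t}=L^\gamma_{s\to r}$ and $L^\gamma_{s\to s}=\mathrm{id}$ for all $r,s,t\in J$. $L$ and $g$ are consistent along $\gamma$ if $g_{\gamma(s)}(u,v)=g_{\gamma(t)}(L^\gamma_{s\to t}u,L^\gamma_{s\to t}v)$ for all $s,t\in J$, $u,v\in\pi^{-1}(\gamma(s))$; they are (globally) consistent if this holds along every path. $G(x)=[g_x(e_i,e_j)]$ for a basis $\{e_i\}$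 of $\pi^{-1}(x)$; it is a Hermitian matrix, and its signature is $p(x)-q(x)$, where $p(x)$ and $q(x)=n-p(x)$ are the numbers of its positive and negative (real) eigenvalues. *)

theory Defs
  imports
    "HOL-Analysis.Analysis"
    "Jordan_Normal_Form.VS_Connect"
    "Jordan_Normal_Form.Char_Poly"
begin

text \<open>
  The total space and the base are the topological spaces \<open>TE\<close> and \<open>TB\<close>.  The record \<open>F x\<close> carries
  the linear structure of the fibre over \<open>x\<close>; its components \<open>mult\<close> and \<open>one\<close>, inherited from
  the ring record, play no role.  Local trivialisations are written as \<open>U \<times> \<complex>\<^sup>n \<rightarrow> \<pi>\<^sup>-\<^sup>1(U)\<close>,
  where \<open>\<complex>\<^sup>n\<close> is topologised as the product of \<open>n\<close> copies of the complex plane.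
\<close>

locale complex_vector_bundle =
  fixes TE :: "'e topology" and TB :: "'b topology"
    and \<pi> :: "'e \<Rightarrow> 'b" and F :: "'b \<Rightarrow> (complex, 'e) module" and n :: nat
  assumes continuous_proj: "continuous_map TE TB \<pi>"
    and carrier_fibre: "x \<in> topspace TB \<Longrightarrow> carrier (F x) = {u \<in> topspace TE. \<pi> u = x}"
    and vectorspace_fibre: "x \<in> topspace TB \<Longrightarrow> vectorspace class_ring (F x)"
    and fin_dim_fibre: "x \<in> topspace TB \<Longrightarrow> vectorspace.fin_dim class_ring (F x)"
    and dim_fibre: "x \<in> topspace TB \<Longrightarrow> vectorspace.dim class_ring (F x) = n"
    and locally_trivial:
      "x \<in> topspace TB \<Longrightarrow>
        \<exists>U \<phi>. openin TB U \<and> x \<in> U \<and>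
          (\<forall>y\<in>U. linear_map class_ring (module_vec TYPE(complex) n) (F y) (\<phi> y)) \<and>
          homeomorphic_map
            (prod_topology (subtopology TB U) (product_topology (\<lambda>_. euclidean) {..<n}))
            (subtopology TE {u \<in> topspace TE. \<pi> u \<in> U})
            (\<lambda>(y, c). \<phi> y (vec n c))"

text \<open>No positive definiteness, and no continuity in the base point.\<close>

definition hermitian_bundle_metric ::
    "'b topology \<Rightarrow> ('b \<Rightarrow> (complex, 'e) module) \<Rightarrow> ('b \<Rightarrow> 'e \<Rightarrow> 'e \<Rightarrow> complex) \<Rightarrow> bool" where
  "hermitian_bundle_metric TB F g \<longleftrightarrow>
    (\<forall>x \<in> topspace TB.
      (\<forall>u\<in>carrier (F x). \<forall>v\<in>carrier (F x). \<forall>w\<in>carrier (F x). \<forall>a b.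
         g x (a \<odot>\<^bsub>F x\<^esub> u \<oplus>\<^bsub>F x\<^esub> b \<odot>\<^bsub>F x\<^esub> v) w = a * g x u w + b * g x v w \<and>
         g x w (a \<odot>\<^bsub>F x\<^esub> u \<oplus>\<^bsub>F x\<^esub> b \<odot>\<^bsub>F x\<^esub> v) = cnj a * g x w u + cnj b * g x w v) \<and>
      (\<forall>u\<in>carrier (F x). \<forall>v\<in>carrier (F x). g x u v = cnj (g x v u)) \<and>
      (\<forall>u\<in>carrier (F x). (\<forall>v\<in>carrier (F x). g x u v = 0) \<longrightarrow> u = \<zero>\<^bsub>F x\<^esub>))"

text \<open>
  A path is an arbitrary map from a real interval into the base; continuity is not part of the
  notion (with continuous paths only, a globally consistent transport could not relate different
  path components of the base).  Paths are extensional functions, so that a transport, being a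
  function of \<open>J\<close> and \<open>\<gamma>\<close>, depends only on the values of \<open>\<gamma>\<close> on \<open>J\<close>.
\<close>

definition base_path :: "'b topology \<Rightarrow> real set \<Rightarrow> (real \<Rightarrow> 'b) \<Rightarrow> bool" where
  "base_path TB J \<gamma> \<longleftrightarrow> is_interval J \<and> \<gamma> \<in> J \<rightarrow>\<^sub>E topspace TB"

text \<open>\<open>L J \<gamma> s t\<close> is the transport from the fibre over \<open>\<gamma> s\<close> to the fibre over \<open>\<gamma> t\<close>.\<close>

definition linear_transport ::
    "'b topology \<Rightarrow> ('b \<Rightarrow> (complex, 'e) module) \<Rightarrow>
      (real set \<Rightarrow> (real \<Rightarrow> 'b) \<Rightarrow> real \<Rightarrow> real \<Rightarrow> 'e \<Rightarrow> 'e) \<Rightarrow> bool" where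
  "linear_transport TB F L \<longleftrightarrow>
    (\<forall>J \<gamma>. base_path TB J \<gamma> \<longrightarrow>
      (\<forall>s\<in>J. \<forall>t\<in>J. linear_map class_ring (F (\<gamma> s)) (F (\<gamma> t)) (L J \<gamma> s t)) \<and>
      (\<forall>r\<in>J. \<forall>s\<in>J. \<forall>t\<in>J. \<forall>u\<in>carrier (F (\<gamma> s)). L J \<gamma> t r (L J \<gamma> s t u) = L J \<gamma> s r u) \<and>
      (\<forall>s\<in>J. \<forall>u\<in>carrier (F (\<gamma> s)). L J \<gamma> s s u = u))"

definition consistent_along ::
    "('b \<Rightarrow> (complex, 'e) module) \<Rightarrow> ('b \<Rightarrow> 'e \<Rightarrow> 'e \<Rightarrow> complex) \<Rightarrow>
      (real set \<Rightarrow> (real \<Rightarrow> 'b) \<Rightarrow> real \<Rightarrow> real \<Rightarrow> 'e \<Rightarrow> 'e) \<Rightarrow> real set \<Rightarrow> (real \<Rightarrow> 'b) \<Rightarrow> bool" where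
  "consistent_along F g L J \<gamma> \<longleftrightarrow>
    (\<forall>s\<in>J. \<forall>t\<in>J. \<forall>u\<in>carrier (F (\<gamma> s)). \<forall>v\<in>carrier (F (\<gamma> s)).
      g (\<gamma> s) u v = g (\<gamma> t) (L J \<gamma> s t u) (L J \<gamma> s t v))"

definition globally_consistent ::
    "'b topology \<Rightarrow> ('b \<Rightarrow> (complex, 'e) module) \<Rightarrow> ('b \<Rightarrow> 'e \<Rightarrow> 'e \<Rightarrow> complex) \<Rightarrow>
      (real set \<Rightarrow> (real \<Rightarrow> 'b) \<Rightarrow> real \<Rightarrow> real \<Rightarrow> 'e \<Rightarrow> 'e) \<Rightarrow> bool" where
  "globally_consistent TB F g L \<longleftrightarrow> (\<forall>J \<gamma>. base_path TB J \<gamma> \<longrightarrow> consistent_along F g L J \<gamma>)"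

text \<open>A choice of an ordered basis in every fibre, with no relation between different fibres.\<close>

definition fibre_bases ::
    "'b topology \<Rightarrow> ('b \<Rightarrow> (complex, 'e) module) \<Rightarrow> nat \<Rightarrow> ('b \<Rightarrow> nat \<Rightarrow> 'e) \<Rightarrow> bool" where
  "fibre_bases TB F n e \<longleftrightarrow>
    (\<forall>x \<in> topspace TB. inj_on (e x) {..<n} \<and> vectorspace.basis class_ring (F x) (e x ` {..<n}))"

definition metric_matrix ::
    "nat \<Rightarrow> ('b \<Rightarrow> nat \<Rightarrow> 'e) \<Rightarrow> ('b \<Rightarrow> 'e \<Rightarrow> 'e \<Rightarrow> complex) \<Rightarrow> 'b \<Rightarrow> complex mat" where
  "metric_matrix n e g x = mat n n (\<lambda>(i, j). g x (e x i) (e x j))"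

text \<open>Eigenvalues are counted with multiplicity, as roots of the characteristic polynomial.\<close>

definition num_pos_eigenvalues :: "complex mat \<Rightarrow> nat" where
  "num_pos_eigenvalues A = size {#z \<in># proots (char_poly A). z \<in> \<real> \<and> Re z > 0#}"

definition num_neg_eigenvalues :: "complex mat \<Rightarrow> nat" where
  "num_neg_eigenvalues A = size {#z \<in># proots (char_poly A). z \<in> \<real> \<and> Re z < 0#}"

definition matrix_signature :: "complex mat \<Rightarrow> int" where
  "matrix_signature A = int (num_pos_eigenvalues A) - int (num_neg_eigenvalues A)"

end

theory Submission
  imports Defs "Jordan_Normal_Form.Schur_Decomposition"
begin

text \<open>
  By the spectral theorem every fibre has a frame in which the metric is diagonal with entries
  \<open>\<plusminus>1\<close>, the \<open>p(x)\<close> entries \<open>+1\<close> coming first.  The maps matching the coordinates in these frames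
  form a transport along arbitrary paths, and they preserve the metric between any two points at
  which \<open>p\<close> agrees.  Conversely, a consistent transport is an isometry between fibres, and Sylvester's
  law of inertia makes \<open>p\<close> constant; in the global case any two base points lie on one path, since
  paths need not be continuous.  As the metric is nondegenerate, \<open>p + q = n\<close>, so the signature,
  \<open>p\<close> and \<open>q\<close> determine one another.
\<close>

no_notation Finite_Cartesian_Product.vec_nth (infixl "$" 90)
notation vec_index (infixl "$" 100)

section \<open>Adjoints and unitary diagonalisation of Hermitian matrices\<close>

lemma dim_mat_adjoint [simp]:
  "dim_row (mat_adjoint A) = dim_col A" "dim_col (mat_adjoint A) = dim_row A"
  by (simp_all add: mat_adjoint_def)

lemma mat_adjoint_carrier: "A \<in> carrier_mat m n \<Longrightarrow> mat_adjoint A \<in> carrier_mat n m"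
  by (rule carrier_matI) simp_all

lemma index_mat_adjoint [simp]:
  fixes A :: "complex mat"
  shows "i < dim_col A \<Longrightarrow> j < dim_row A \<Longrightarrow> mat_adjoint A $$ (i, j) = cnj (A $$ (j, i))"
  by (simp add: mat_adjoint_def mat_of_rows_def)

lemma mat_adjoint_adjoint [simp]: "mat_adjoint (mat_adjoint A) = (A :: complex mat)"
  by (rule eq_matI) auto

lemma mat_adjoint_one [simp]: "mat_adjoint (1\<^sub>m n :: complex mat) = 1\<^sub>m n"
  by (rule eq_matI) auto

lemma mat_adjoint_mult:
  fixes A :: "complex mat"
  assumes "A \<in> carrier_mat m n" "B \<in> carrier_mat n k"
  shows "mat_adjoint (A * B) = mat_adjoint B * mat_adjoint A"
  by (rule eq_matI) (use assms in \<open>auto simp: scalar_prod_def mult.commute\<close>)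

lemma mat_adjoint_four_block:
  fixes A :: "complex mat"
  assumes "A \<in> carrier_mat m m" "D \<in> carrier_mat n n"
  shows "mat_adjoint (four_block_mat A (0\<^sub>m m n) (0\<^sub>m n m) D)
    = four_block_mat (mat_adjoint A) (0\<^sub>m m n) (0\<^sub>m n m) (mat_adjoint D)"
  by (rule eq_matI) (use assms in auto)

text \<open>\<open>W\<close> is the Householder reflection along \<open>u = \<beta> v - e\<^sub>0\<close>.  Scaling \<open>v\<close> so that \<open>\<beta> v\<close> has norm \<open>1\<close> and
  real first entry gives \<open>u\<^sup>*u = -2 u\<^sub>0\<close>, whence \<open>W e\<^sub>0 = \<beta> v\<close>.  If \<open>u = 0\<close>, then \<open>2 / s = 0\<close> makes \<open>W\<close>
  the identity.\<close>

lemma householder_reflection: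
  fixes v :: "complex vec"
  assumes v: "v \<in> carrier_vec n" "v \<noteq> 0\<^sub>v n"
  obtains W \<beta> where "W \<in> carrier_mat n n" "mat_adjoint W = W" "W * W = 1\<^sub>m n"
    "\<beta> \<noteq> 0" "col W 0 = \<beta> \<cdot>\<^sub>v v"
proof -
  obtain k where k: "k < n" "v $ k \<noteq> 0"
    using v by (metis carrier_vecD eq_vecI index_zero_vec(1) index_zero_vec(2))
  hence n: "0 < n" by simp
  define N where "N = (\<Sum>i<n. (cmod (v $ i))\<^sup>2)"
  have N: "N > 0"
    unfolding N_def using k by (intro sum_pos2[of _ k]) auto
  \<comment> \<open>Rotates the first entry of \<open>v\<close> onto its modulus. If that entry is
    0, every phase works and 1 is taken.\<close>
  define \<alpha> :: complex where "\<alpha> = (if v $ 0 = 0 then 1 else cnj (v $ 0) / cmod (v $ 0))"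
  define \<beta> where "\<beta> = \<alpha> / sqrt N"
  have a: "cmod \<alpha> = 1" by (auto simp: \<alpha>_def norm_divide)
  have b: "\<beta> \<noteq> 0" using a N by (auto simp: \<beta>_def)
  define w where "w i = \<beta> * v $ i" for i
  have "\<alpha> * v $ 0 = cmod (v $ 0)"
    using complex_norm_square[of "v $ 0"]
    by (auto simp: \<alpha>_def power2_eq_square field_simps)
  hence w0: "w 0 = complex_of_real (cmod (v $ 0) / sqrt N)"
    by (simp add: w_def \<beta>_def)
  have "(\<Sum>i<n. w i * cnj (w i)) = (\<Sum>i<n. complex_of_real ((cmod (v $ i))\<^sup>2 / N))"
  proof (rule sum.cong)
    fix i
    have "w i * cnj (w i) = complex_of_real ((cmod (w i))\<^sup>2)" by (rule complex_norm_square[symmetric])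
    also have "cmod (w i) = cmod (v $ i) / sqrt N"
      using a N by (simp add: w_def \<beta>_def norm_mult norm_divide)
    also have "\<dots>\<^sup>2 = (cmod (v $ i))\<^sup>2 / N" using N by (simp add: power_divide)
    finally show "w i * cnj (w i) = complex_of_real ((cmod (v $ i))\<^sup>2 / N)" .
  qed simp
  also have "\<dots> = of_real (N / N)"
    by (simp only: N_def sum_divide_distrib of_real_sum)
  finally have wn: "(\<Sum>i<n. w i * cnj (w i)) = 1" using N by simp
  define u where "u i = w i - (if i = 0 then 1 else 0)" for i
  define s where "s = (\<Sum>i<n. u i * cnj (u i))"
  have "s = (\<Sum>i<n. w i * cnj (w i) + (if i = 0 then 1 - w 0 - cnj (w 0) else 0))"
    unfolding s_def u_def by (rule sum.cong) (auto simp: algebra_simps)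
  also have "\<dots> = 2 - 2 * w 0" using n w0 by (simp add: sum.distrib wn)
  finally have s: "s = -2 * u 0" by (simp add: u_def)
  have u0: "cnj (u 0) = u 0" by (simp add: u_def w0)
  have s0: "u i = 0" if "s = 0" "i < n" for i
  proof -
    have "s = of_real (\<Sum>i<n. (cmod (u i))\<^sup>2)"
      unfolding s_def of_real_sum by (simp only: complex_norm_square)
    hence "(\<Sum>i<n. (cmod (u i))\<^sup>2) = 0" using that by (metis of_real_eq_0_iff)
    thus ?thesis using that by (subst (asm) sum_nonneg_eq_0_iff) auto
  qed
  define c where "c = 2 / s"
  \<comment> \<open>The second identity makes the quadratic term of \<open>W * W\<close> cancel the
    linear one. It survives \<open>s = 0\<close>, where division by 0 gives
    \<open>c = 0\<close>.\<close>
  have c: "cnj c = c" "c * c * s = 2 * c"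
  proof -
    have "cnj s = s" by (simp add: s u0)
    thus "cnj c = c" by (simp add: c_def)
    show "c * c * s = 2 * c" by (cases "s = 0") (simp_all add: c_def)
  qed
  define W where "W = mat n n (\<lambda>(i, j). (if i = j then 1 else 0) - c * u i * cnj (u j))"
  have W: "W \<in> carrier_mat n n" by (simp add: W_def)
  moreover have "mat_adjoint W = W"
    by (rule eq_matI) (auto simp: W_def c)
  moreover have "W * W = 1\<^sub>m n"
  proof (rule eq_matI)
    fix i j assume ij: "i < dim_row (1\<^sub>m n)" "j < dim_col (1\<^sub>m n)"
    hence "(W * W) $$ (i, j) = (\<Sum>k<n. ((if i = k then 1 else 0) - c * u i * cnj (u k)) *
        ((if k = j then 1 else 0) - c * u k * cnj (u j)))"
      by (simp add: W_def scalar_prod_def atLeast0LessThan)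
    also have "\<dots> = (\<Sum>k<n. (if i = k then (if k = j then 1 else 0) - c * u k * cnj (u j) else 0)
        + (if k = j then - c * u i * cnj (u k) else 0) + c * c * u i * cnj (u j) * (u k * cnj (u k)))"
      by (rule sum.cong) (auto simp: algebra_simps)
    also have "\<dots> = (if i = j then 1 else 0) - 2 * c * u i * cnj (u j) + c * c * u i * cnj (u j) * s"
      using ij by (simp add: sum.distrib s_def flip: sum_distrib_left)
    also have "c * c * u i * cnj (u j) * s = 2 * c * u i * cnj (u j)"
    proof -
      have "c * c * u i * cnj (u j) * s = (c * c * s) * u i * cnj (u j)" by (simp only: mult_ac)
      thus ?thesis by (simp only: c(2))
    qed
    finally show "(W * W) $$ (i, j) = 1\<^sub>m n $$ (i, j)" using ij by simp
  qed (auto simp: W_def)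
  moreover have "col W 0 = \<beta> \<cdot>\<^sub>v v"
  proof (rule eq_vecI)
    fix i assume "i < dim_vec (\<beta> \<cdot>\<^sub>v v)"
    hence i: "i < n" using v by simp
    \<comment> \<open>Since \<open>s = -2 * u 0\<close>, the product \<open>c * u 0\<close> is -1
      unless \<open>s = 0\<close>, in which case all of \<open>u\<close> vanishes.\<close>
    have "c * u i * u 0 = - u i"
    proof (cases "s = 0")
      case True thus ?thesis using s0[OF True i] by simp
    next
      case False
      hence "u 0 \<noteq> 0" by (simp add: s)
      thus ?thesis by (simp add: c_def s)
    qed
    moreover have "col W 0 $ i = (if i = 0 then 1 else 0) - c * u i * u 0"
      using i n by (simp add: W_def u0)
    ultimately have "col W 0 $ i = (if i = 0 then 1 else 0) + u i" by simp
    also have "\<dots> = w i" by (simp only: u_def) simp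
    finally show "col W 0 $ i = (\<beta> \<cdot>\<^sub>v v) $ i"
      using i v(1) by (simp only: w_def index_smult_vec carrier_vecD)
  qed (use v in \<open>auto simp: W_def\<close>)
  ultimately show ?thesis using b by (intro that[of W \<beta>])
qed

text \<open>Deflation: a reflection moves an eigenvector for the first root to the first coordinate
  axis, the Hermitian matrix then splits off that root as a 1 by 1 block, and induction handles the
  other block. The diagonal follows the order of \<open>es\<close>, so a caller prescribes it by the
  order of the linear factors.\<close>

lemma hermitian_unitary_diagonalisation:
  fixes A :: "complex mat"
  assumes "A \<in> carrier_mat n n" "mat_adjoint A = A" "char_poly A = (\<Prod>e\<leftarrow>es. [:- e, 1:])"
  shows "\<exists>P \<in> carrier_mat n n. P * mat_adjoint P = 1\<^sub>m n \<and>
    mat_adjoint P * A * P = mat_diag n (\<lambda>i. es ! i)"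
  using assms
proof (induction es arbitrary: n A)
  case Nil
  hence "n = 0" using degree_monic_char_poly[OF Nil.prems(1)] by simp
  thus ?case
    by (intro bexI[of _ "1\<^sub>m 0"] conjI eq_matI) (auto simp: mat_diag_def)
next
  case (Cons e es)
  note A = Cons.prems(1)
  have "n = degree (\<Prod>e\<leftarrow>e # es. [:- e, 1:])"
    using degree_monic_char_poly[OF A] unfolding Cons.prems(3) by simp
  also have "\<dots> = Suc (length es)" by (subst degree_linear_factors) simp
  finally have "n = Suc (length es)" .
  then obtain m where n: "n = Suc m" and m: "m = length es" by blast
  have "eigenvalue A e"
    unfolding eigenvalue_root_char_poly[OF A] Cons.prems(3) by simp
  then obtain v where v: "v \<in> carrier_vec n" "v \<noteq> 0\<^sub>v n" "A *\<^sub>v v = e \<cdot>\<^sub>v v"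
    using A by (auto simp: eigenvalue_def eigenvector_def)
  obtain W \<beta> where W: "W \<in> carrier_mat n n" "mat_adjoint W = W" "W * W = 1\<^sub>m n"
    and Wv: "\<beta> \<noteq> 0" "col W 0 = \<beta> \<cdot>\<^sub>v v"
    by (rule householder_reflection[OF v(1,2)])
  define B where "B = W * A * W"
  have B: "B \<in> carrier_mat n n" using A W by (simp add: B_def)
  have adjB: "mat_adjoint B = B"
    using A W Cons.prems(2) unfolding B_def
    by (simp add: mat_adjoint_mult[of _ n n _ n] assoc_mult_mat[of _ n n _ n _ n])
  have cW: "col W 0 \<in> carrier_vec n" using W by (metis carrier_matD(1) col_dim)
  \<comment> \<open>\<open>W\<close> maps the first unit vector to a multiple of \<open>v\<close>,
    \<open>A\<close> scales this by \<open>e\<close>, and the involution \<open>W\<close> takes it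
    back.\<close>
  have "col B 0 = W *\<^sub>v (A *\<^sub>v col W 0)"
    using A W n unfolding B_def
    using cW by (subst col_mult2[of _ n n _ n])
      (auto intro!: assoc_mult_mat_vec simp del: col_dim)
  also have "A *\<^sub>v col W 0 = e \<cdot>\<^sub>v col W 0"
    using A v by (simp add: Wv mult_mat_vec[of _ n n] smult_smult_assoc mult.commute)
  also have "W *\<^sub>v (e \<cdot>\<^sub>v col W 0) = e \<cdot>\<^sub>v col (W * W) 0"
    using W n by (subst col_mult2[of _ n n _ n]) (auto simp: mult_mat_vec[of _ n n])
  finally have colB: "col B 0 = e \<cdot>\<^sub>v unit_vec n 0"
    using W n by simp
  have Bi0: "B $$ (i, 0) = (if i = 0 then e else 0)" if "i < n" for i
  proof -
    have "B $$ (i, 0) = col B 0 $ i" using B that n by simp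
    thus ?thesis using colB that n by simp
  qed
  have B0j: "B $$ (0, j) = 0" if "j < n" "j \<noteq> 0" for j
  proof -
    have "B $$ (0, j) = cnj (B $$ (j, 0))"
      using index_mat_adjoint[of 0 B j] adjB B that n by simp
    thus ?thesis using Bi0[of j] that by simp
  qed
  define C where "C = mat m m (\<lambda>(i, j). B $$ (Suc i, Suc j))"
  have C: "C \<in> carrier_mat m m" by (simp add: C_def)
  define E where "E = mat 1 1 (\<lambda>_. e)"
  have E: "E \<in> carrier_mat 1 1" by (simp add: E_def)
  have block: "B = four_block_mat E (0\<^sub>m 1 m) (0\<^sub>m m 1) C"
    using B by (intro eq_matI) (auto simp: n E_def C_def Bi0 B0j)
  have adjC: "mat_adjoint C = C"
  proof (rule eq_matI)
    fix i j assume "i < dim_row C" "j < dim_col C"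
    thus "mat_adjoint C $$ (i, j) = C $$ (i, j)"
      using index_mat_adjoint[of "Suc i" B "Suc j"] adjB B n by (simp add: C_def)
  qed (auto simp: C_def)
  have "similar_mat_wit A B W W"
    by (rule similar_mat_witI[of _ _ n])
       (use A B W in \<open>simp_all add: B_def assoc_mult_mat[of _ n n _ n _ n] flip: assoc_mult_mat[of W n n W n _ n]\<close>)
  hence "char_poly A = char_poly B"
    by (intro char_poly_similar) (auto simp: similar_mat_def)
  also have "\<dots> = char_poly E * char_poly C"
    unfolding block by (rule char_poly_four_block_zeros_col[OF E _ C]) simp
  also have "char_poly E = [:- e, 1:]"
    by (simp add: E_def char_poly_defs det_def sign_def)
  finally have "char_poly C = (\<Prod>e\<leftarrow>es. [:- e, 1:])"
    unfolding Cons.prems(3) by (simp del: mult_pCons_left)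
  from Cons.IH[OF C adjC this] obtain Q where Q: "Q \<in> carrier_mat m m"
    "Q * mat_adjoint Q = 1\<^sub>m m" "mat_adjoint Q * C * Q = mat_diag m (\<lambda>i. es ! i)" by blast
  define R where "R = four_block_mat (1\<^sub>m 1) (0\<^sub>m 1 m) (0\<^sub>m m 1) Q"
  have R: "R \<in> carrier_mat n n"
    unfolding R_def n using four_block_carrier_mat[OF one_carrier_mat[of 1] Q(1)] by simp
  have aQ: "mat_adjoint Q \<in> carrier_mat m m" by (rule mat_adjoint_carrier[OF Q(1)])
  have adjR: "mat_adjoint R = four_block_mat (1\<^sub>m 1) (0\<^sub>m 1 m) (0\<^sub>m m 1) (mat_adjoint Q)"
    unfolding R_def using Q(1) by (subst mat_adjoint_four_block) auto
  have "R * mat_adjoint R = 1\<^sub>m n"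
    unfolding adjR unfolding R_def
    using Q(1,2) aQ by (subst mult_four_block_mat[of _ 1 1 _ m _ m _ _ 1 _ m])
      (auto simp: n intro!: eq_matI)
  have "mat_adjoint R * B * R = four_block_mat E (0\<^sub>m 1 m) (0\<^sub>m m 1) (mat_adjoint Q * C * Q)"
    unfolding adjR block unfolding R_def
    using Q(1) C E aQ mult_carrier_mat[OF aQ C]
    by (simp add: mult_four_block_mat[of _ 1 1 _ m _ m _ _ 1 _ m] del: One_nat_def)
  also have "\<dots> = mat_diag n (\<lambda>i. (e # es) ! i)"
    unfolding Q(3) by (rule eq_matI) (auto simp: n E_def mat_diag_def nth_Cons')
  finally have RBR: "mat_adjoint R * B * R = mat_diag n (\<lambda>i. (e # es) ! i)" .
  have adj: "mat_adjoint (W * R) = mat_adjoint R * W"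
    using W R by (simp add: mat_adjoint_mult[of _ n n _ n])
  have aR: "mat_adjoint R \<in> carrier_mat n n" by (rule mat_adjoint_carrier[OF R])
  have "W * R * mat_adjoint (W * R) = W * (R * mat_adjoint R) * W"
    unfolding adj using W R aR by (simp add: assoc_mult_mat[of _ n n _ n _ n])
  also have "\<dots> = 1\<^sub>m n" using W \<open>R * mat_adjoint R = 1\<^sub>m n\<close> by simp
  finally have 1: "W * R * mat_adjoint (W * R) = 1\<^sub>m n" .
  have "mat_adjoint (W * R) * A * (W * R) = mat_adjoint R * B * R"
    unfolding adj B_def using W R aR A by (simp add: assoc_mult_mat[of _ n n _ n _ n])
  thus ?case using 1 W R RBR by (intro bexI[of _ "W * R"]) auto
qed

section \<open>Eigenvalue counts and the diagonal form with entries 1 and -1\<close>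

lemma proots_linear_factors: "proots (\<Prod>e\<leftarrow>es. [:- e, 1 :: complex:]) = mset es"
proof (induction es)
  case (Cons e es)
  have "(\<Prod>e\<leftarrow>es. [:- e, 1 :: complex:]) \<noteq> 0" by (auto simp: prod_list_zero_iff)
  thus ?case using Cons.IH by (simp add: proots_mult del: mult_pCons_left)
qed simp

lemma prod_list_partition:
  fixes f :: "'a \<Rightarrow> 'b :: comm_monoid_mult"
  shows "prod_list (map f (filter P xs @ filter (\<lambda>x. \<not> P x) xs)) = prod_list (map f xs)"
  by (induction xs) (auto simp: mult_ac)

text \<open>Congruence keeps a matrix Hermitian, so the diagonal matrix equals its own
  adjoint.\<close>

lemma hermitian_eigenvalues_real:
  fixes A :: "complex mat"
  assumes "A \<in> carrier_mat n n" "mat_adjoint A = A" "P \<in> carrier_mat n n"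
    and "mat_adjoint P * A * P = mat_diag n d" and "i < n"
  shows "d i \<in> \<real>"
proof -
  note aP = mat_adjoint_carrier[OF assms(3)]
  have "mat_adjoint (mat_diag n d) = mat_diag n d"
    unfolding assms(4)[symmetric] using assms(1-3) aP
    by (simp add: mat_adjoint_mult[of _ n n _ n] assoc_mult_mat[of _ n n _ n _ n])
  moreover have "mat_adjoint (mat_diag n d) $$ (i, i) = cnj (d i)"
    using assms(5) by (simp add: mat_diag_def)
  ultimately have "cnj (d i) = d i" using assms(5) by (simp add: mat_diag_def)
  thus ?thesis using Reals_cnj_iff by blast
qed

text \<open>Nondegeneracy excludes the eigenvalue 0, so every root of the characteristic polynomial
  is real with a definite sign. Unitary diagonalisation followed by rescaling gives the congruence.
  \<open>V\<close> witnesses that \<open>W\<close> is invertible, so that the old basis can be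
  recovered from the new vectors.\<close>

lemma hermitian_inertia:
  fixes A :: "complex mat"
  assumes A: "A \<in> carrier_mat n n" "mat_adjoint A = A"
    and nondeg: "\<And>v. v \<in> carrier_vec n \<Longrightarrow> A *\<^sub>v v = 0\<^sub>v n \<Longrightarrow> v = 0\<^sub>v n"
  shows "num_pos_eigenvalues A + num_neg_eigenvalues A = n"
    and "\<exists>W \<in> carrier_mat n n. \<exists>V \<in> carrier_mat n n. W * V = 1\<^sub>m n \<and>
      mat_adjoint W * A * W = mat_diag n (\<lambda>i. if i < num_pos_eigenvalues A then 1 else - 1)"
proof -
  define pos :: "complex \<Rightarrow> bool" where "pos z \<longleftrightarrow> z \<in> \<real> \<and> Re z > 0" for z
  obtain es0 where es0: "char_poly A = (\<Prod>e\<leftarrow>es0. [:- e, 1:])" "length es0 = n"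
    using char_poly_factorized[OF A(1)] by blast
  \<comment> \<open>The roots are rearranged before diagonalising, so that an index below
    \<open>length ps\<close> belongs to a positive eigenvalue.\<close>
  define ps where "ps = filter pos es0"
  define ns where "ns = filter (\<lambda>z. \<not> pos z) es0"
  define es where "es = ps @ ns"
  have cp: "char_poly A = (\<Prod>e\<leftarrow>es. [:- e, 1:])"
    unfolding es0(1) es_def ps_def ns_def by (rule prod_list_partition[symmetric])
  have len: "length es = n"
    unfolding es_def ps_def ns_def es0(2)[symmetric] using sum_length_filter_compl[of pos es0] by simp
  obtain P where P: "P \<in> carrier_mat n n" "P * mat_adjoint P = 1\<^sub>m n"
    and D: "mat_adjoint P * A * P = mat_diag n (\<lambda>i. es ! i)"
    using hermitian_unitary_diagonalisation[OF A cp] by blast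
  have real: "z \<in> \<real>" if "z \<in> set es" for z
    using that hermitian_eigenvalues_real[OF A P(1) D] len by (auto simp: in_set_conv_nth)
  have nz: "z \<noteq> 0" if "z \<in> set es" for z
  proof
    assume "z = 0"
    hence "poly (char_poly A) 0 = 0"
      using that unfolding cp by (auto simp: poly_prod_list prod_list_zero_iff)
    hence "eigenvalue A 0" using eigenvalue_root_char_poly[OF A(1)] by blast
    then obtain v where "v \<in> carrier_vec n" "v \<noteq> 0\<^sub>v n" "A *\<^sub>v v = 0 \<cdot>\<^sub>v v"
      using A(1) by (auto simp: eigenvalue_def eigenvector_def)
    moreover from this have "0 \<cdot>\<^sub>v v = 0\<^sub>v n" by (intro eq_vecI) auto
    ultimately show False using nondeg[of v] by simp
  qed
  have pos_ps: "z \<in> \<real> \<and> Re z > 0" if "z \<in> set ps" for z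
    using that by (simp add: ps_def pos_def)
  have neg_ns: "z \<in> \<real> \<and> Re z < 0" if "z \<in> set ns" for z
  proof -
    have "\<not> pos z" "z \<in> set es" using that by (auto simp: ns_def es_def)
    thus ?thesis using real[of z] nz[of z] by (auto simp: pos_def Reals_def)
  qed
  have p: "num_pos_eigenvalues A = length ps"
  proof -
    have "filter (\<lambda>z. z \<in> \<real> \<and> Re z > 0) es = ps"
      unfolding es_def filter_append using pos_ps neg_ns
      by (subst (1) filter_True, blast, subst filter_False) fastforce+
    thus ?thesis
      unfolding num_pos_eigenvalues_def cp proots_linear_factors by (metis mset_filter size_mset)
  qed
  have q: "num_neg_eigenvalues A = length ns"
  proof -
    have "filter (\<lambda>z. z \<in> \<real> \<and> Re z < 0) es = ns"
      unfolding es_def filter_append using pos_ps neg_ns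
      by (subst (1) filter_False, fastforce, subst filter_True) auto
    thus ?thesis
      unfolding num_neg_eigenvalues_def cp proots_linear_factors by (metis mset_filter size_mset)
  qed
  show "num_pos_eigenvalues A + num_neg_eigenvalues A = n"
    unfolding p q using len by (simp add: es_def)
  define r where "r i = sqrt \<bar>Re (es ! i)\<bar>" for i
  have r: "r i \<noteq> 0" "es ! i = (if i < length ps then 1 else - 1) * complex_of_real (r i * r i)"
    if "i < n" for i
  proof -
    have "es ! i \<in> set es" using that len by simp
    hence e: "es ! i = complex_of_real (Re (es ! i))" "es ! i \<noteq> 0" using real nz by simp_all
    hence "Re (es ! i) \<noteq> 0" by (metis of_real_0)
    thus "r i \<noteq> 0" by (simp add: r_def)
    have "Re (es ! i) > 0" if "i < length ps"
      using that pos_ps[of "es ! i"] by (simp add: es_def nth_append)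
    moreover have "Re (es ! i) < 0" if "\<not> i < length ps"
    proof -
      have "i - length ps < length ns" using that \<open>i < n\<close> len by (simp add: es_def)
      thus ?thesis using that neg_ns[of "ns ! (i - length ps)"] by (simp add: es_def nth_append)
    qed
    ultimately have "Re (es ! i) = (if i < length ps then 1 else - 1) * (r i * r i)"
      by (auto simp: r_def)
    thus "es ! i = (if i < length ps then 1 else - 1) * complex_of_real (r i * r i)"
      using e(1) by (metis (full_types) of_real_1 of_real_minus of_real_mult)
  qed
  \<comment> \<open>Scaling on both sides by \<open>1 / r i\<close> leaves only the sign of the
    eigenvalue. \<open>T\<close> undoes the scaling and enters the right inverse
    \<open>T * mat_adjoint P\<close> of \<open>P * S\<close>.\<close>
  define S where "S = mat_diag n (\<lambda>i. complex_of_real (1 / r i))"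
  define T where "T = mat_diag n (\<lambda>i. complex_of_real (r i))"
  have ST: "S \<in> carrier_mat n n" "T \<in> carrier_mat n n" by (simp_all add: S_def T_def)
  note aP = mat_adjoint_carrier[OF P(1)]
  have "S * T = 1\<^sub>m n"
    unfolding S_def T_def mat_diag_diag using r(1) by (intro eq_matI) (auto simp: mat_diag_def)
  hence "P * S * (T * mat_adjoint P) = 1\<^sub>m n"
    using P ST aP by (simp add: assoc_mult_mat[of _ n n _ n _ n] flip: assoc_mult_mat[of S n n T n _ n])
  moreover have "mat_adjoint (P * S) * A * (P * S) =
      mat_diag n (\<lambda>i. if i < num_pos_eigenvalues A then 1 else - 1)"
  proof -
    have "mat_adjoint S = S" by (rule eq_matI) (auto simp: S_def mat_diag_def)
    hence "mat_adjoint (P * S) * A * (P * S) = S * (mat_adjoint P * A * P) * S"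
      using P ST aP A by (simp add: mat_adjoint_mult[of _ n n _ n] assoc_mult_mat[of _ n n _ n _ n])
    also have "\<dots> = mat_diag n (\<lambda>i. if i < num_pos_eigenvalues A then 1 else - 1)"
      unfolding D S_def mat_diag_diag
    proof (rule eq_matI)
      fix i j
      assume "i < dim_row (mat_diag n (\<lambda>i. if i < num_pos_eigenvalues A then 1 else - 1 :: complex))"
        and "j < dim_col (mat_diag n (\<lambda>i. if i < num_pos_eigenvalues A then 1 else - 1 :: complex))"
      hence ij: "i < n" "j < n" by (simp_all add: mat_diag_def)
      show "mat_diag n (\<lambda>i. complex_of_real (1 / r i) * es ! i * complex_of_real (1 / r i)) $$ (i, j)
          = mat_diag n (\<lambda>i. if i < num_pos_eigenvalues A then 1 else - 1) $$ (i, j)"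
        using ij r[OF ij(1)] by (auto simp: mat_diag_def p)
    qed (simp_all add: mat_diag_def)
    finally show ?thesis .
  qed
  ultimately show "\<exists>W \<in> carrier_mat n n. \<exists>V \<in> carrier_mat n n. W * V = 1\<^sub>m n \<and>
      mat_adjoint W * A * W = mat_diag n (\<lambda>i. if i < num_pos_eigenvalues A then 1 else - 1)"
    using mult_carrier_mat[OF P(1) ST(1)] mult_carrier_mat[OF ST(2) aP] by blast
qed

section \<open>Forms, ordered bases and Gram matrices\<close>

text \<open>Coefficients are attached to indices instead of vectors, so the family may contain
  repetitions, as the image of a frame under a linear map can.\<close>

definition comb :: "(complex, 'e, 'z) module_scheme \<Rightarrow> nat \<Rightarrow> (nat \<Rightarrow> 'e) \<Rightarrow> (nat \<Rightarrow> complex) \<Rightarrow> 'e" where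
  "comb V n f c = (\<Oplus>\<^bsub>V\<^esub>i\<in>{..<n}. c i \<odot>\<^bsub>V\<^esub> f i)"

text \<open>Nondegeneracy is left to the extensions, where it takes two shapes: tested on all
  vectors in \<open>hermitian_space\<close>, and through comparison with a frame in
  \<open>framed_space\<close>. Conjugate-linearity in the second argument comes from
  \<open>herm\<close>.\<close>

locale sesquilinear_space = vectorspace class_ring V
  for V :: "(complex, 'e, 'z) module_scheme" (structure) +
  fixes h :: "'e \<Rightarrow> 'e \<Rightarrow> complex"
  assumes lin: "\<lbrakk>u \<in> carrier V; v \<in> carrier V; w \<in> carrier V\<rbrakk> \<Longrightarrow>
      h (a \<odot>\<^bsub>V\<^esub> u \<oplus>\<^bsub>V\<^esub> b \<odot>\<^bsub>V\<^esub> v) w = a * h u w + b * h v w"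
    and herm: "\<lbrakk>u \<in> carrier V; v \<in> carrier V\<rbrakk> \<Longrightarrow> h u v = cnj (h v u)"
begin

text \<open>The primed facts have plain complex scalars in place of \<open>class_ring\<close>, so
  that the simplifier can apply them.\<close>

lemma smult_closed' [simp]: "u \<in> carrier V \<Longrightarrow> a \<odot>\<^bsub>V\<^esub> u \<in> carrier V"
  by (rule smult_closed) (simp_all add: class_ring_simps)

lemma smult_one' [simp]: "u \<in> carrier V \<Longrightarrow> 1 \<odot>\<^bsub>V\<^esub> u = u"
  using smult_one[of u] by (simp add: class_ring_simps)

lemma smult_zero' [simp]: "u \<in> carrier V \<Longrightarrow> 0 \<odot>\<^bsub>V\<^esub> u = \<zero>\<^bsub>V\<^esub>"
  using smult_l_null[of u] by (simp add: class_ring_simps)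

lemma form_add:
  "\<lbrakk>u \<in> carrier V; v \<in> carrier V; w \<in> carrier V\<rbrakk> \<Longrightarrow> h (u \<oplus>\<^bsub>V\<^esub> v) w = h u w + h v w"
  using lin[of u v w 1 1] by simp

lemma form_smult:
  "\<lbrakk>u \<in> carrier V; w \<in> carrier V\<rbrakk> \<Longrightarrow> h (a \<odot>\<^bsub>V\<^esub> u) w = a * h u w"
  using lin[of u u w a 0] by simp

lemma form_zero: "w \<in> carrier V \<Longrightarrow> h \<zero>\<^bsub>V\<^esub> w = 0"
  using form_smult[of w w 0] by simp

lemma comb_0 [simp]: "comb V 0 f c = \<zero>\<^bsub>V\<^esub>"
  by (simp add: comb_def)

lemma comb_Suc:
  assumes "\<And>i. i < Suc n \<Longrightarrow> f i \<in> carrier V"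
  shows "comb V (Suc n) f c = c n \<odot>\<^bsub>V\<^esub> f n \<oplus>\<^bsub>V\<^esub> comb V n f c"
  unfolding comb_def lessThan_Suc using assms by (subst finsum_insert) auto

lemma comb_closed:
  assumes "\<And>i. i < n \<Longrightarrow> f i \<in> carrier V"
  shows "comb V n f c \<in> carrier V"
  unfolding comb_def using assms by (intro finsum_closed) auto

lemma form_comb:
  assumes "\<And>i. i < n \<Longrightarrow> f i \<in> carrier V" "w \<in> carrier V"
  shows "h (comb V n f c) w = (\<Sum>i<n. c i * h (f i) w)"
  using assms(1)
proof (induction n)
  case 0
  show ?case using assms(2) by (simp add: form_zero)
next
  case (Suc n)
  thus ?case
    using assms(2) by (simp add: comb_Suc form_add form_smult comb_closed)
qed

lemma form_comb_right:
  assumes "\<And>i. i < n \<Longrightarrow> f i \<in> carrier V" "w \<in> carrier V"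
  shows "h w (comb V n f c) = (\<Sum>i<n. cnj (c i) * h w (f i))"
proof -
  have "h w (comb V n f c) = cnj (h (comb V n f c) w)"
    using assms by (intro herm comb_closed)
  also have "\<dots> = (\<Sum>i<n. cnj (c i) * cnj (h (f i) w))"
    using assms by (simp add: form_comb)
  also have "\<dots> = (\<Sum>i<n. cnj (c i) * h w (f i))"
    using assms herm[of w] by (intro sum.cong) auto
  finally show ?thesis .
qed

end

locale hermitian_space = sesquilinear_space V h
  for V :: "(complex, 'e, 'z) module_scheme" (structure) and h +
  fixes n :: nat and e :: "nat \<Rightarrow> 'e"
  assumes nondeg: "\<lbrakk>u \<in> carrier V; \<And>v. v \<in> carrier V \<Longrightarrow> h u v = 0\<rbrakk> \<Longrightarrow> u = \<zero>\<^bsub>V\<^esub>"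
    and inj_e: "inj_on e {..<n}"
    and basis_e: "basis (e ` {..<n})"
begin

lemma e_closed [simp]: "i < n \<Longrightarrow> e i \<in> carrier V"
  using basis_e by (auto simp: basis_def)

lemma lincomb_e: "lincomb a (e ` {..<n}) = comb V n e (\<lambda>i. a (e i))"
  unfolding lincomb_def comb_def by (rule finsum_reindex[OF _ inj_e]) auto

lemma e_spans:
  assumes "u \<in> carrier V"
  obtains c where "u = comb V n e c"
proof -
  have "e ` {..<n} \<subseteq> carrier V" by auto
  hence "\<exists>!a. a \<in> e ` {..<n} \<rightarrow>\<^sub>E carrier class_ring \<and> lincomb a (e ` {..<n}) = u"
    using basis_criterion[of "e ` {..<n}"] basis_e assms by blast
  thus ?thesis using that lincomb_e by metis
qed

lemma e_independent:
  assumes "comb V n e c = \<zero>\<^bsub>V\<^esub>" "i < n"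
  shows "c i = 0"
proof (rule ccontr)
  assume "c i \<noteq> 0"
  \<comment> \<open>Linear dependence takes coefficients indexed by vectors; injectivity of
    \<open>e\<close> allows \<open>c\<close> to be moved there.\<close>
  define a where "a v = c (inv_into {..<n} e v)" for v
  have a: "a (e j) = c j" if "j < n" for j
    using inj_e that by (simp add: a_def)
  have "lincomb a (e ` {..<n}) = comb V n e c"
    unfolding lincomb_e comb_def by (rule finsum_cong') (auto simp: a)
  moreover have "a (e i) \<noteq> 0" using a \<open>c i \<noteq> 0\<close> assms(2) by simp
  ultimately have "lin_dep (e ` {..<n})"
    using assms by (intro lin_dep_crit[of "e ` {..<n}" _ a "e i"]) (auto simp: class_ring_simps)
  thus False using basis_e by (simp add: basis_def)
qed

lemma eqI_e:
  assumes "u \<in> carrier V" "v \<in> carrier V" "\<And>i. i < n \<Longrightarrow> h u (e i) = h v (e i)"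
  shows "u = v"
proof -
  have "h u w = h v w" if w: "w \<in> carrier V" for w
  proof -
    obtain c where "w = comb V n e c" using e_spans[OF w] .
    thus ?thesis using assms by (simp add: form_comb_right)
  qed
  \<comment> \<open>Both \<open>u\<close> and \<open>v\<close> have sum zero with -1 times
    \<open>v\<close>, and cancelling this summand equates them.\<close>
  hence "u \<oplus>\<^bsub>V\<^esub> (- 1) \<odot>\<^bsub>V\<^esub> v = \<zero>\<^bsub>V\<^esub>"
    using assms by (intro nondeg) (auto simp: form_add form_smult)
  moreover have "v \<oplus>\<^bsub>V\<^esub> (- 1) \<odot>\<^bsub>V\<^esub> v = \<zero>\<^bsub>V\<^esub>"
    using assms by (intro nondeg) (auto simp: form_add form_smult)
  ultimately show ?thesis
    using assms by (metis add.right_cancel smult_closed')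
qed

definition gram :: "complex mat" where
  "gram = mat n n (\<lambda>(i, j). h (e i) (e j))"

lemma gram_carrier: "gram \<in> carrier_mat n n"
  by (simp add: gram_def)

lemma gram_hermitian: "mat_adjoint gram = gram"
  by (rule eq_matI) (auto simp: gram_def herm[symmetric])

lemma gram_nondegenerate:
  assumes "v \<in> carrier_vec n" "gram *\<^sub>v v = 0\<^sub>v n"
  shows "v = 0\<^sub>v n"
proof -
  \<comment> \<open>The form is conjugate-linear on the right, so with conjugated coefficients entry
    \<open>i\<close> of \<open>gram *\<^sub>v v\<close> is \<open>h (e i) u\<close>.\<close>
  define u where "u = comb V n e (\<lambda>j. cnj (v $ j))"
  have u: "u \<in> carrier V" by (simp add: u_def comb_closed)
  have "h u (e i) = h \<zero>\<^bsub>V\<^esub> (e i)" if "i < n" for i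
  proof -
    have "h (e i) u = (gram *\<^sub>v v) $ i"
      using that assms(1) unfolding u_def
      by (simp add: form_comb_right gram_def scalar_prod_def atLeast0LessThan mult.commute)
    hence "h (e i) u = 0" using assms(2) that by simp
    thus ?thesis using herm[OF u e_closed[OF that]] that by (simp add: form_zero)
  qed
  hence "u = \<zero>\<^bsub>V\<^esub>" by (intro eqI_e u) auto
  hence "cnj (v $ i) = 0" if "i < n" for i
    using e_independent[of "\<lambda>j. cnj (v $ j)"] that by (simp add: u_def)
  thus ?thesis using assms(1) by (intro eq_vecI) auto
qed

end

section \<open>Frames in which the form is diagonal with entries 1 and -1\<close>

text \<open>\<open>eqI_f\<close> stands in for spanning and nondegeneracy: vectors are compared
  through their products with the frame, and \<open>comb_coordinates\<close> derives expansions from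
  that. Nothing here bounds \<open>p\<close> by \<open>n\<close>, hence the separate condition in
  \<open>inertia_le\<close>.\<close>

locale framed_space = sesquilinear_space V h
  for V :: "(complex, 'e, 'z) module_scheme" (structure) and h +
  fixes n p :: nat and f :: "nat \<Rightarrow> 'e"
  assumes f_closed [simp]: "i < n \<Longrightarrow> f i \<in> carrier V"
    and orthonormal: "\<lbrakk>i < n; j < n\<rbrakk> \<Longrightarrow>
      h (f i) (f j) = (if i = j then if i < p then 1 else - 1 else 0)"
    and eqI_f: "\<lbrakk>u \<in> carrier V; v \<in> carrier V; \<And>i. i < n \<Longrightarrow> h u (f i) = h v (f i)\<rbrakk> \<Longrightarrow> u = v"

lemma (in hermitian_space) framed_space_exists:
  "\<exists>f. framed_space V h n (num_pos_eigenvalues gram) f"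
proof -
  let ?p = "num_pos_eigenvalues gram"
  obtain W U where W: "W \<in> carrier_mat n n" and U: "U \<in> carrier_mat n n" and WU: "W * U = 1\<^sub>m n"
    and D: "mat_adjoint W * gram * W = mat_diag n (\<lambda>i. if i < ?p then 1 else - 1)"
    using hermitian_inertia(2)[OF gram_carrier gram_hermitian gram_nondegenerate] by blast
  \<comment> \<open>The frame comes from the columns of \<open>W\<close>. Conjugation makes
    \<open>h w (f i)\<close> linear in the entries of \<open>W\<close>, so that the Gram matrix of
    \<open>f\<close> is \<open>mat_adjoint W * gram * W\<close>.\<close>
  define f where "f i = comb V n e (\<lambda>k. cnj (W $$ (k, i)))" for i
  have f: "f i \<in> carrier V" for i by (simp add: f_def comb_closed)
  have hf: "h w (f i) = (\<Sum>k<n. W $$ (k, i) * h w (e k))" if "w \<in> carrier V" for w i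
    using that by (simp add: f_def form_comb_right)
  show ?thesis
  proof (intro exI framed_space.intro framed_space_axioms.intro sesquilinear_space_axioms)
    show "f i \<in> carrier V" for i by (fact f)
  next
    fix i j assume ij: "i < n" "j < n"
    have "mat_diag n (\<lambda>i. if i < ?p then 1 else - 1) $$ (i, j)
        = (\<Sum>k<n. (\<Sum>l<n. cnj (W $$ (l, i)) * h (e l) (e k)) * W $$ (k, j))"
      unfolding D[symmetric]
      using ij W by (simp add: gram_def scalar_prod_def atLeast0LessThan)
    also have "\<dots> = h (f i) (f j)"
      by (simp add: hf[OF f] mult.commute) (simp add: f_def form_comb mult.commute)
    finally show "h (f i) (f j) = (if i = j then if i < ?p then 1 else - 1 else 0)"
      using ij by (auto simp: mat_diag_def)
  next
    fix u v assume uv: "u \<in> carrier V" "v \<in> carrier V" and eq: "\<And>i. i < n \<Longrightarrow> h u (f i) = h v (f i)"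
    show "u = v"
    proof (rule eqI_e[OF uv])
      fix k assume k: "k < n"
      \<comment> \<open>\<open>U\<close> inverts the change of basis, so products with
        \<open>e\<close> are recovered from those with \<open>f\<close>.\<close>
      have expand: "h w (e k) = (\<Sum>j<n. h w (f j) * U $$ (j, k))" if w: "w \<in> carrier V" for w
      proof -
        have "(\<Sum>j<n. h w (f j) * U $$ (j, k)) = (\<Sum>j<n. \<Sum>i<n. W $$ (i, j) * h w (e i) * U $$ (j, k))"
          by (simp add: hf[OF w] sum_distrib_right)
        also have "\<dots> = (\<Sum>i<n. h w (e i) * (\<Sum>j<n. W $$ (i, j) * U $$ (j, k)))"
          by (subst sum.swap) (simp add: sum_distrib_left mult_ac)
        also have "\<dots> = (\<Sum>i<n. h w (e i) * (W * U) $$ (i, k))"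
          using W U k by (intro sum.cong) (auto simp: scalar_prod_def atLeast0LessThan)
        also have "\<dots> = (\<Sum>i<n. if i = k then h w (e i) else 0)"
          unfolding WU using k by (intro sum.cong) auto
        also have "\<dots> = h w (e k)" using k by simp
        finally show ?thesis ..
      qed
      show "h u (e k) = h v (e k)" using eq by (simp add: expand uv)
    qed
  qed
qed

context framed_space
begin

lemma form_comb_frame:
  assumes "j < n"
  shows "h (comb V n f c) (f j) = (if j < p then 1 else - 1) * c j"
proof -
  have "h (comb V n f c) (f j) = (\<Sum>i<n. c i * h (f i) (f j))"
    using assms by (simp add: form_comb)
  also have "\<dots> = (\<Sum>i<n. if i = j then (if j < p then 1 else - 1) * c j else 0)"
    using assms by (intro sum.cong) (auto simp: orthonormal)
  also have "\<dots> = (if j < p then 1 else - 1) * c j" using assms by simp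
  finally show ?thesis .
qed

text \<open>Each sign is its own inverse, so both vectors have the same products with the
  frame.\<close>

lemma comb_coordinates:
  assumes "u \<in> carrier V"
  shows "comb V n f (\<lambda>i. (if i < p then 1 else - 1) * h u (f i)) = u"
  using assms by (intro eqI_f comb_closed) (auto simp: form_comb_frame)

lemma form_eq_sum:
  assumes "u \<in> carrier V" "v \<in> carrier V"
  shows "h u v = (\<Sum>i<n. (if i < p then 1 else - 1) * (h u (f i) * cnj (h v (f i))))"
proof -
  have "h u v = h (comb V n f (\<lambda>i. (if i < p then 1 else - 1) * h u (f i))) v"
    using assms by (simp add: comb_coordinates)
  also have "\<dots> = (\<Sum>i<n. (if i < p then 1 else - 1) * h u (f i) * h (f i) v)"
    using assms by (intro form_comb) auto
  also have "\<dots> = (\<Sum>i<n. (if i < p then 1 else - 1) * (h u (f i) * cnj (h v (f i))))"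
    using assms herm[of _ v] by (intro sum.cong) auto
  finally show ?thesis .
qed

text \<open>Shows the sign of the form on vectors whose coordinates vanish on one side of
  \<open>p\<close>, which is what the inertia argument compares.\<close>

lemma Re_form_self:
  assumes "u \<in> carrier V"
  shows "Re (h u u) = (\<Sum>i<n. (if i < p then 1 else - 1) * (cmod (h u (f i)))\<^sup>2)"
proof -
  have "Re ((if i < p then 1 else - 1) * (h u (f i) * cnj (h u (f i))))
      = (if i < p then 1 else - 1) * (cmod (h u (f i)))\<^sup>2" for i
    by (auto simp: complex_norm_square[symmetric])
  thus ?thesis by (subst form_eq_sum[OF assms assms]) (simp only: Re_sum)
qed

end

section \<open>Sylvester's law of inertia\<close>

lemma linear_map_comb:
  assumes T: "linear_map class_ring V V' T" and f: "\<And>i. i < n \<Longrightarrow> f i \<in> carrier V"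
    and "sesquilinear_space V h" "sesquilinear_space V' h'"
  shows "T (comb V n f c) = comb V' n (\<lambda>i. T (f i)) c"
proof -
  interpret linear_map class_ring V V' T by (rule T)
  interpret V1: sesquilinear_space V h by fact
  interpret V2: sesquilinear_space V' h' by fact
  from f show ?thesis
  proof (induction n)
    case 0
    show ?case by simp
  next
    case (Suc n)
    have "T (f i) \<in> carrier V'" if "i < Suc n" for i using Suc.prems[OF that] by (rule T_im)
    thus ?case
      using Suc by (simp add: V1.comb_Suc V2.comb_Suc V1.comb_closed class_ring_simps)
  qed
qed

text \<open>If \<open>p' < p\<close>, some nonzero combination of the first \<open>p\<close> frame vectors of \<open>V\<close> has image orthogonal
  to the first \<open>p'\<close> frame vectors of \<open>V'\<close>: the square system \<open>A\<close> of these conditions has a zero row,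
  namely row \<open>p'\<close>.  The form is positive on that combination but nonpositive on its image.\<close>

lemma inertia_le:
  assumes "framed_space V h n p f" "framed_space V' h' n p' f'"
    and T: "linear_map class_ring V V' T"
    and iso: "\<And>u v. \<lbrakk>u \<in> carrier V; v \<in> carrier V\<rbrakk> \<Longrightarrow> h u v = h' (T u) (T v)"
    and "p \<le> n"
  shows "p \<le> p'"
proof (rule ccontr)
  assume "\<not> p \<le> p'"
  hence p': "p' < p" "p' < n" using assms by simp_all
  interpret V1: framed_space V h n p f by fact
  interpret V2: framed_space V' h' n p' f' by fact
  interpret linear_map class_ring V V' T by (rule T)
  define A where "A = mat n n (\<lambda>(i, j). if i < p' then h' (T (f j)) (f' i)
    else if i \<ge> p \<and> i = j then 1 else 0)"
  have A: "A \<in> carrier_mat n n" by (simp add: A_def)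
  \<comment> \<open>The zero row puts a unit vector into the kernel of the transpose, so the
    determinant is 0.\<close>
  have "A\<^sup>T *\<^sub>v unit_vec n p' = row A p'"
    using A p' by (intro eq_vecI) auto
  also have "\<dots> = 0\<^sub>v n" using p' by (intro eq_vecI) (auto simp: A_def)
  finally have "Determinant.det (A\<^sup>T) = 0"
    using A p' by (subst det_0_iff_vec_prod_zero[of _ n]) (auto intro!: exI[of _ "unit_vec n p'"])
  hence "Determinant.det A = 0" using A by (simp add: det_transpose)
  then obtain v where v: "v \<in> carrier_vec n" "v \<noteq> 0\<^sub>v n" "A *\<^sub>v v = 0\<^sub>v n"
    using det_0_iff_vec_prod_zero[OF A] by blast
  have Av: "(\<Sum>j<n. A $$ (i, j) * v $ j) = 0" if "i < n" for i
  proof -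
    have "(\<Sum>j<n. A $$ (i, j) * v $ j) = (A *\<^sub>v v) $ i"
      using that v(1) A by (simp add: scalar_prod_def atLeast0LessThan)
    thus ?thesis using v(3) that by simp
  qed
  define u where "u = comb V n f (\<lambda>j. v $ j)"
  have u: "u \<in> carrier V" by (simp add: u_def V1.comb_closed)
  have huf: "h u (f i) = (if i < p then 1 else - 1) * v $ i" if "i < n" for i
    using that by (simp add: u_def V1.form_comb_frame)
  \<comment> \<open>Rows of \<open>A\<close> from \<open>p\<close> on are rows of the identity,
    which confines \<open>v\<close> to the first \<open>p\<close> indices.\<close>
  have v0: "v $ i = 0" if "i < n" "i \<ge> p" for i
  proof -
    have "(\<Sum>j<n. A $$ (i, j) * v $ j) = (\<Sum>j<n. if i = j then v $ j else 0)"
      using that p' by (intro sum.cong) (auto simp: A_def)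
    thus ?thesis using Av[OF that(1)] that by simp
  qed
  have Tu: "T u \<in> carrier V'" using u by (rule T_im)
  have Tu0: "h' (T u) (f' i) = 0" if "i < n" "i < p'" for i
  proof -
    have "T u = comb V' n (\<lambda>j. T (f j)) (\<lambda>j. v $ j)"
      unfolding u_def
      by (rule linear_map_comb[OF T _ V1.sesquilinear_space_axioms V2.sesquilinear_space_axioms]) simp
    hence "h' (T u) (f' i) = (\<Sum>j<n. v $ j * h' (T (f j)) (f' i))"
      using that by (simp add: V2.form_comb)
    also have "\<dots> = (\<Sum>j<n. A $$ (i, j) * v $ j)"
      using that by (intro sum.cong) (auto simp: A_def)
    finally show ?thesis using Av that by simp
  qed
  obtain k where k: "k < n" "v $ k \<noteq> 0"
    using v(1,2) by (metis carrier_vecD eq_vecI index_zero_vec(1) index_zero_vec(2))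
  hence "k < p" using v0 by (meson not_le)
  have "0 < (\<Sum>i<n. (if i < p then 1 else - 1) * (cmod (h u (f i)))\<^sup>2)"
    using k \<open>k < p\<close> by (intro sum_pos2[of _ k]) (auto simp: huf v0)
  hence "0 < Re (h u u)" using V1.Re_form_self[OF u] by simp
  moreover have "Re (h' (T u) (T u)) \<le> 0"
    unfolding V2.Re_form_self[OF Tu] by (intro sum_nonpos) (auto simp: Tu0)
  ultimately show False using iso[OF u u] by simp
qed

section \<open>Maps matching coordinates in two frames\<close>

text \<open>By \<open>comb_coordinates\<close>, the coefficients are the coordinates of
  \<open>u\<close> in \<open>f\<close>; they are reused with the frame \<open>f'\<close>. Equality
  of the two inertia indices enters only through the isometry property.\<close>

definition frame_map where
  "frame_map V' f' h n p f u = comb V' n f' (\<lambda>i. (if i < p then 1 else - 1) * h u (f i))"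

context
  fixes V :: "(complex, 'e, 'z) module_scheme" and V' :: "(complex, 'e, 'z) module_scheme"
    and h h' n p p' f f'
  assumes V: "framed_space V h n p f" and V': "framed_space V' h' n p' f'"
begin

interpretation V1: framed_space V h n p f by (fact V)
interpretation V2: framed_space V' h' n p' f' by (fact V')

lemma frame_map_closed: "frame_map V' f' h n p f u \<in> carrier V'"
  unfolding frame_map_def by (rule V2.comb_closed) simp

lemma form_frame_map:
  "i < n \<Longrightarrow> h' (frame_map V' f' h n p f u) (f' i) =
    (if i < p' then 1 else - 1) * ((if i < p then 1 else - 1) * h u (f i))"
  unfolding frame_map_def by (rule V2.form_comb_frame)

lemma frame_map_linear: "linear_map class_ring V V' (frame_map V' f' h n p f)"
proof -
  let ?T = "frame_map V' f' h n p f"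
  have "?T (u \<oplus>\<^bsub>V\<^esub> v) = ?T u \<oplus>\<^bsub>V'\<^esub> ?T v" if "u \<in> carrier V" "v \<in> carrier V" for u v
    using that by (intro V2.eqI_f) (auto simp: frame_map_closed form_frame_map V1.form_add V2.form_add)
  moreover have "?T (a \<odot>\<^bsub>V\<^esub> u) = a \<odot>\<^bsub>V'\<^esub> ?T u" if "u \<in> carrier V" for a u
    using that by (intro V2.eqI_f) (auto simp: frame_map_closed form_frame_map V1.form_smult V2.form_smult)
  ultimately have "?T \<in> module_hom class_ring V V'"
    by (simp add: module_hom_def frame_map_closed)
  thus ?thesis
    by (intro linear_map.intro mod_hom.intro mod_hom_axioms.intro
        V1.vectorspace_axioms V2.vectorspace_axioms V1.module_axioms V2.module_axioms)
qed

lemma frame_map_isometry: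
  assumes "p = p'" "u \<in> carrier V" "v \<in> carrier V"
  shows "h u v = h' (frame_map V' f' h n p f u) (frame_map V' f' h n p f v)"
  unfolding V1.form_eq_sum[OF assms(2,3)] V2.form_eq_sum[OF frame_map_closed frame_map_closed]
  by (intro sum.cong) (auto simp: form_frame_map[unfolded assms(1)] assms(1))

text \<open>The sign of \<open>p'\<close> appears once in the product with \<open>f' i\<close> and
  once in the outer coefficient, and the two cancel.\<close>

lemma frame_map_comp:
  assumes "framed_space V'' h'' n p'' f''"
  shows "frame_map V'' f'' h' n p' f' (frame_map V' f' h n p f u) = frame_map V'' f'' h n p f u"
proof -
  interpret V3: framed_space V'' h'' n p'' f'' by fact
  show ?thesis
    unfolding frame_map_def[of V''] comb_def
    by (rule V3.finsum_cong') (auto simp: form_frame_map)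
qed

end

lemma (in framed_space) frame_map_same:
  "u \<in> carrier V \<Longrightarrow> frame_map V f h n p f u = u"
  unfolding frame_map_def by (rule comb_coordinates)

section \<open>From the fibres to the bundle\<close>

lemma (in hermitian_space) num_eigenvalues_gram:
  "num_pos_eigenvalues gram + num_neg_eigenvalues gram = n"
  by (rule hermitian_inertia(1)[OF gram_carrier gram_hermitian gram_nondegenerate])

theorem proposition4p4:
  fixes TE :: "'e topology" and TB :: "'b topology"
    and \<pi> :: "'e \<Rightarrow> 'b" and F :: "'b \<Rightarrow> (complex, 'e) module" and n :: nat
    and g :: "'b \<Rightarrow> 'e \<Rightarrow> 'e \<Rightarrow> complex" and e :: "'b \<Rightarrow> nat \<Rightarrow> 'e"
  assumes "complex_vector_bundle TE TB \<pi> F n"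
    and "hermitian_bundle_metric TB F g"
    and "fibre_bases TB F n e"
  defines "G \<equiv> metric_matrix n e g"
  shows
    "((\<exists>L. linear_transport TB F L \<and> globally_consistent TB F g L) \<longleftrightarrow>
        (\<lambda>x. matrix_signature (G x)) constant_on topspace TB) \<and>
     (\<forall>J \<gamma>. base_path TB J \<gamma> \<longrightarrow>
        ((\<exists>L. linear_transport TB F L \<and> consistent_along F g L J \<gamma>) \<longleftrightarrow>
          (\<lambda>x. matrix_signature (G x)) constant_on (\<gamma> ` J))) \<and>
     (\<forall>S \<subseteq> topspace TB.
        ((\<lambda>x. matrix_signature (G x)) constant_on S \<longleftrightarrow>
          (\<lambda>x. num_pos_eigenvalues (G x)) constant_on S) \<and>
        ((\<lambda>x. matrix_signature (G x)) constant_on S \<longleftrightarrow>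
          (\<lambda>x. num_neg_eigenvalues (G x)) constant_on S))"
proof -
  define p where "p x = num_pos_eigenvalues (G x)" for x
  have space: "hermitian_space (F x) (g x) n (e x)" if x: "x \<in> topspace TB" for x
  proof -
    have "vectorspace class_ring (F x)"
      using assms(1) x by (rule complex_vector_bundle.vectorspace_fibre)
    thus ?thesis
      using assms(2,3) x
      unfolding hermitian_space_def sesquilinear_space_def hermitian_space_axioms_def
        sesquilinear_space_axioms_def hermitian_bundle_metric_def fibre_bases_def
      by blast
  qed
  have G: "G x = hermitian_space.gram (g x) n (e x)" if "x \<in> topspace TB" for x
    unfolding G_def metric_matrix_def hermitian_space.gram_def[OF space[OF that]] ..
  have pq: "p x + num_neg_eigenvalues (G x) = n" if "x \<in> topspace TB" for x
    unfolding p_def G[OF that] by (rule hermitian_space.num_eigenvalues_gram[OF space[OF that]])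
  have signature: "matrix_signature (G x) = 2 * int (p x) - int n" if "x \<in> topspace TB" for x
    using pq[OF that] by (simp add: matrix_signature_def p_def)
  \<comment> \<open>Constancy is restated as equality of \<open>p\<close> at any two points, the
    form in which isometries between fibres deliver it.\<close>
  have sig_iff: "(\<lambda>x. matrix_signature (G x)) constant_on S \<longleftrightarrow> (\<forall>x\<in>S. \<forall>y\<in>S. p x = p y)"
    if "S \<subseteq> topspace TB" for S
  proof -
    have "matrix_signature (G x) = matrix_signature (G y) \<longleftrightarrow> p x = p y" if "x \<in> S" "y \<in> S" for x y
      using signature[of x] signature[of y] that \<open>S \<subseteq> topspace TB\<close> by fastforce
    thus ?thesis unfolding constant_on_def by metis
  qed
  have pos_iff: "(\<lambda>x. num_pos_eigenvalues (G x)) constant_on S \<longleftrightarrow> (\<forall>x\<in>S. \<forall>y\<in>S. p x = p y)" for S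
    unfolding constant_on_def p_def by metis
  have neg_iff: "(\<lambda>x. num_neg_eigenvalues (G x)) constant_on S \<longleftrightarrow> (\<forall>x\<in>S. \<forall>y\<in>S. p x = p y)"
    if "S \<subseteq> topspace TB" for S
  proof -
    have "num_neg_eigenvalues (G x) = num_neg_eigenvalues (G y) \<longleftrightarrow> p x = p y"
      if "x \<in> S" "y \<in> S" for x y
      using pq[of x] pq[of y] that \<open>S \<subseteq> topspace TB\<close> by fastforce
    thus ?thesis unfolding constant_on_def by metis
  qed
  have "\<exists>f. framed_space (F x) (g x) n (p x) f" if "x \<in> topspace TB" for x
    unfolding p_def G[OF that] by (rule hermitian_space.framed_space_exists[OF space[OF that]])
  then obtain fr where fr: "\<And>x. x \<in> topspace TB \<Longrightarrow> framed_space (F x) (g x) n (p x) (fr x)"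
    by metis
  \<comment> \<open>One frame per base point is fixed in advance, so the map depends only on
    \<open>\<gamma> s\<close> and \<open>\<gamma> t\<close>. This gives a transport along all paths,
    as the local case also demands, even if consistency holds along one path only.\<close>
  define L :: "real set \<Rightarrow> (real \<Rightarrow> 'b) \<Rightarrow> real \<Rightarrow> real \<Rightarrow> 'e \<Rightarrow> 'e" where
    "L J \<gamma> s t = frame_map (F (\<gamma> t)) (fr (\<gamma> t)) (g (\<gamma> s)) n (p (\<gamma> s)) (fr (\<gamma> s))" for J \<gamma> s t
  have path: "\<gamma> s \<in> topspace TB" if "base_path TB J \<gamma>" "s \<in> J" for J \<gamma> s
    using that by (auto simp: base_path_def)
  have transport: "linear_transport TB F L"
    unfolding linear_transport_def L_def
  proof (intro allI impI conjI ballI)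
    fix J \<gamma> assume J: "base_path TB J \<gamma>"
    note fr' = fr[OF path[OF J]]
    show "linear_map class_ring (F (\<gamma> s)) (F (\<gamma> t))
        (frame_map (F (\<gamma> t)) (fr (\<gamma> t)) (g (\<gamma> s)) n (p (\<gamma> s)) (fr (\<gamma> s)))"
      if "s \<in> J" "t \<in> J" for s t
      by (rule frame_map_linear[OF fr'[OF that(1)] fr'[OF that(2)]])
    show "frame_map (F (\<gamma> r)) (fr (\<gamma> r)) (g (\<gamma> t)) n (p (\<gamma> t)) (fr (\<gamma> t))
        (frame_map (F (\<gamma> t)) (fr (\<gamma> t)) (g (\<gamma> s)) n (p (\<gamma> s)) (fr (\<gamma> s)) u)
      = frame_map (F (\<gamma> r)) (fr (\<gamma> r)) (g (\<gamma> s)) n (p (\<gamma> s)) (fr (\<gamma> s)) u"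
      if "r \<in> J" "s \<in> J" "t \<in> J" for r s t u
      by (rule frame_map_comp[OF fr'[OF that(2)] fr'[OF that(3)] fr'[OF that(1)]])
    show "frame_map (F (\<gamma> s)) (fr (\<gamma> s)) (g (\<gamma> s)) n (p (\<gamma> s)) (fr (\<gamma> s)) u = u"
      if "s \<in> J" "u \<in> carrier (F (\<gamma> s))" for s u
      by (rule framed_space.frame_map_same[OF fr'[OF that(1)] that(2)])
  qed
  have consistent: "consistent_along F g L J \<gamma>"
    if "base_path TB J \<gamma>" "\<forall>x\<in>\<gamma> ` J. \<forall>y\<in>\<gamma> ` J. p x = p y" for J \<gamma>
    unfolding consistent_along_def L_def
  proof (intro ballI)
    fix s t u v
    assume st: "s \<in> J" "t \<in> J" and uv: "u \<in> carrier (F (\<gamma> s))" "v \<in> carrier (F (\<gamma> s))"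
    have "p (\<gamma> s) = p (\<gamma> t)" using that(2) st by blast
    thus "g (\<gamma> s) u v =
        g (\<gamma> t) (frame_map (F (\<gamma> t)) (fr (\<gamma> t)) (g (\<gamma> s)) n (p (\<gamma> s)) (fr (\<gamma> s)) u)
          (frame_map (F (\<gamma> t)) (fr (\<gamma> t)) (g (\<gamma> s)) n (p (\<gamma> s)) (fr (\<gamma> s)) v)"
      by (rule frame_map_isometry[OF fr[OF path[OF that(1) st(1)]] fr[OF path[OF that(1) st(2)]] _ uv])
  qed
  have p_eq: "p (\<gamma> s) = p (\<gamma> t)"
    if "linear_transport TB F M" "consistent_along F g M J \<gamma>" "base_path TB J \<gamma>" "s \<in> J" "t \<in> J"
    for M J \<gamma> s t
  proof -
    \<comment> \<open>Shown for every ordered pair, because the reverse inequality comes from the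
      map from \<open>t\<close> back to \<open>s\<close>.\<close>
    have "p (\<gamma> s) \<le> p (\<gamma> t)" if "s \<in> J" "t \<in> J" for s t
    proof (rule inertia_le)
      show "framed_space (F (\<gamma> s)) (g (\<gamma> s)) n (p (\<gamma> s)) (fr (\<gamma> s))"
        and "framed_space (F (\<gamma> t)) (g (\<gamma> t)) n (p (\<gamma> t)) (fr (\<gamma> t))"
        using that \<open>base_path TB J \<gamma>\<close> by (auto intro: fr path)
      show "linear_map class_ring (F (\<gamma> s)) (F (\<gamma> t)) (M J \<gamma> s t)"
        using \<open>linear_transport TB F M\<close> \<open>base_path TB J \<gamma>\<close> that
        unfolding linear_transport_def by blast
      show "g (\<gamma> s) u v = g (\<gamma> t) (M J \<gamma> s t u) (M J \<gamma> s t v)"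
        if "u \<in> carrier (F (\<gamma> s))" "v \<in> carrier (F (\<gamma> s))" for u v
        using \<open>consistent_along F g M J \<gamma>\<close> \<open>s \<in> J\<close> \<open>t \<in> J\<close> that
        unfolding consistent_along_def by blast
      show "p (\<gamma> s) \<le> n"
        using pq[OF path[OF \<open>base_path TB J \<gamma>\<close> \<open>s \<in> J\<close>]] by simp
    qed
    from this[of s t] this[of t s] that show ?thesis by simp
  qed
  have global: "(\<exists>L. linear_transport TB F L \<and> globally_consistent TB F g L) \<longleftrightarrow>
      (\<forall>x\<in>topspace TB. \<forall>y\<in>topspace TB. p x = p y)" (is "?l \<longleftrightarrow> ?r")
  proof
    assume ?l
    then obtain M where M: "linear_transport TB F M" "globally_consistent TB F g M" by blast
    show ?r
    proof (intro ballI)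
      fix x y assume xy: "x \<in> topspace TB" "y \<in> topspace TB"
      \<comment> \<open>The path sits at \<open>x\<close> for parameter 0 and at \<open>y\<close>
        for all later ones; \<open>restrict\<close> supplies the extensionality demanded by
        \<open>base_path\<close>.\<close>
      define \<gamma> where "\<gamma> = restrict (\<lambda>t :: real. if t = 0 then x else y) {0..1}"
      have "base_path TB {0..1} \<gamma>"
        using xy by (auto simp: base_path_def \<gamma>_def is_interval_cc)
      hence "p (\<gamma> 0) = p (\<gamma> 1)"
        using M by (intro p_eq[of M "{0..1}"]) (auto simp: globally_consistent_def)
      thus "p x = p y" by (simp add: \<gamma>_def)
    qed
  next
    assume ?r
    hence "globally_consistent TB F g L"
      unfolding globally_consistent_def using path by (auto intro!: consistent)
    thus ?l using transport by blast
  qed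
  have local: "(\<exists>L. linear_transport TB F L \<and> consistent_along F g L J \<gamma>) \<longleftrightarrow>
      (\<forall>x\<in>\<gamma> ` J. \<forall>y\<in>\<gamma> ` J. p x = p y)" if "base_path TB J \<gamma>" for J \<gamma>
  proof
    assume "\<exists>L. linear_transport TB F L \<and> consistent_along F g L J \<gamma>"
    then obtain M where M: "linear_transport TB F M" "consistent_along F g M J \<gamma>" by blast
    thus "\<forall>x\<in>\<gamma> ` J. \<forall>y\<in>\<gamma> ` J. p x = p y" using p_eq[OF M that] by blast
  next
    assume "\<forall>x\<in>\<gamma> ` J. \<forall>y\<in>\<gamma> ` J. p x = p y"
    thus "\<exists>L. linear_transport TB F L \<and> consistent_along F g L J \<gamma>"
      using transport consistent[OF that] by blast
  qed
  have image: "\<gamma> ` J \<subseteq> topspace TB" if "base_path TB J \<gamma>" for J \<gamma>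
    using path[OF that] by blast
  show ?thesis
    using global local image by (simp add: sig_iff pos_iff neg_iff)
qed

end
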